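(* For any positive integer $k$ and any real number $r>1$, the range of the function $\sigma_{-r,k}\colon S_k\to\mathbb{R}$ is a subset of the interval $\left[1,\frac{\zeta(r)}{\zeta((k+1)r)}\right)$.
   Context: $\mathbb{N}$ denotes the set of positive integers, $\mathbb{P}$ the set of primes, and $\zeta$ the Riemann zeta function. For a positive integer $k$, $S_k=\{n\in\mathbb{N}: p^{k+1}\nmid n \text{ for all } p\in\mathbb{P}\}$. For real $t$, $\sigma_t\colon\mathbb{N}\to\mathbb{R}$ is $\sigma_t(n)=\sum_{d\mid n,\ d>0}d^t$, and $\sigma_{t,k}\colon S_k\to\mathbb{R}$ is the restriction of $\sigma_t$ to $S_k$. *)

theory Defs
  imports "HOL-Analysis.Analysis" "HOL-Computational_Algebra.Primes"
begin

definition S :: "nat \<Rightarrow> nat set" where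
  "S k = {n. n > 0 \<and> (\<forall>p. prime p \<longrightarrow> \<not> p ^ (k + 1) dvd n)}"

definition sigma :: "real \<Rightarrow> nat \<Rightarrow> real" where
  "sigma t n = (\<Sum>d | d dvd n \<and> d > 0. real d powr t)"

definition sigma_on :: "real \<Rightarrow> nat \<Rightarrow> nat \<Rightarrow> real" where
  "sigma_on t k = restrict (sigma t) (S k)"

(* The Dirichlet series represents the Riemann zeta function at real arguments s > 1;
   at other arguments the value is meaningless. *)
definition zeta :: "real \<Rightarrow> real" where
  "zeta s = (\<Sum>n. 1 / real (Suc n) powr s)"

end

theory Submission
  imports Defs
begin

text \<open>
  The quotient of zeta values is the Dirichlet series of the integers without a
  $(k+1)$-st power of a prime, but no Euler product is needed for the bound. For \<open>n \<in> S k\<close>,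
  multiply out
  \[ \sigma_{-r}(n)\, \zeta((k+1)r) = \sum_{d \mid n} \sum_{m \ge 1} (d\, m^{k+1})^{-r} . \]
  Every divisor \<open>d\<close> of \<open>n\<close> lies in \<open>S k\<close> again, and an integer has at most one
  representation $d\, m^{k+1}$ with \<open>d \<in> S k\<close> (\<open>S_times_power_unique\<close>). Hence the double
  sum runs over distinct positive integers, which makes it a subsum of \<open>zeta r\<close>. A prime
  exceeding \<open>n\<close> is not $d\, m^{k+1}$ for any divisor \<open>d\<close> of \<open>n\<close>, so a positive term is left out and the
  inequality is strict (\<open>sigma_times_zeta_less\<close>). Dividing by $\zeta((k+1)r) > 0$ gives the
  upper bound; the divisor 1 alone gives the lower bound.
\<close>

text \<open>
  Unordered summation over the positive integers allows the series to be restricted to an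
  arbitrary subset and reindexed, which the ordered sum with shifted index does not.
\<close>

lemma zeta_has_sum:
  fixes s :: real
  assumes "s > 1"
  shows "((\<lambda>n::nat. real n powr (- s)) has_sum zeta s) {0<..}"
proof -
  have "summable (\<lambda>n. real n powr (- s))"
    using assms by (simp add: summable_real_powr_iff)
  hence "summable (\<lambda>n. real (Suc n) powr (- s))"
    by (subst summable_Suc_iff)
  hence "summable (\<lambda>n. 1 / real (Suc n) powr s)"
    by (simp only: powr_minus_divide)
  hence "((\<lambda>n. 1 / real (Suc n) powr s) has_sum zeta s) UNIV"
    unfolding zeta_def by (intro norm_summable_imp_has_sum summable_sums) auto
  hence "((\<lambda>n. real n powr (- s)) has_sum zeta s) (range Suc)"
    by (subst has_sum_reindex) (simp_all add: powr_minus_divide comp_def)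
  moreover have "range Suc = {0<..}"
    by (auto simp: image_iff intro: gr0_conv_Suc[THEN iffD1])
  ultimately show ?thesis by simp
qed

lemma zeta_pos:
  fixes s :: real
  assumes "s > 1"
  shows "zeta s > 0"
proof -
  have "((\<lambda>n::nat. real n powr (- s)) has_sum 1) {1}"
    using has_sum_finite[of "{1::nat}" "\<lambda>n. real n powr (- s)"] by simp
  hence "1 \<le> zeta s"
    by (rule has_sum_mono_neutral[OF _ zeta_has_sum[OF assms]]) auto
  thus ?thesis by simp
qed

lemma S_dvd:
  assumes "n \<in> S k" "d dvd n"
  shows "d \<in> S k"
  using assms unfolding S_def by (auto intro: dvd_trans dest: dvd_pos_nat)

lemma S_power_dvd_eq_1:
  assumes "d \<in> S k" "b ^ (k + 1) dvd d"
  shows "b = 1"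
proof (rule ccontr)
  assume "b \<noteq> 1"
  then obtain p where "prime p" "p dvd b"
    using prime_factor_nat by blast
  hence "p ^ (k + 1) dvd d"
    using assms(2) dvd_power_same dvd_trans by blast
  with assms(1) \<open>prime p\<close> show False
    by (auto simp: S_def)
qed

text \<open>
  After cancelling the common factor of \<open>m\<close> and \<open>m'\<close>, their cofactors are coprime, so the
  $(k+1)$-st power of each divides the opposite element of \<open>S k\<close> and must be 1.
\<close>

lemma S_times_power_unique:
  assumes "d \<in> S k" "d' \<in> S k" "m > 0" "m' > 0"
    and eq: "d * m ^ (k + 1) = d' * m' ^ (k + 1)"
  shows "d = d' \<and> m = m'"
proof -
  define g where "g = gcd m m'"
  have "g > 0" using assms by (simp add: g_def)
  obtain a b where ab: "m = a * g" "m' = b * g" "coprime a b"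
    using gcd_coprime_exists[of m m'] \<open>g > 0\<close> unfolding g_def by auto
  have "d * a ^ (k + 1) * g ^ (k + 1) = d' * b ^ (k + 1) * g ^ (k + 1)"
    using eq unfolding ab power_mult_distrib by (simp only: mult.assoc)
  hence eq': "d * a ^ (k + 1) = d' * b ^ (k + 1)"
    using \<open>g > 0\<close> by simp
  have cop: "coprime (a ^ (k + 1)) (b ^ (k + 1))"
    using ab(3) by simp
  have "b ^ (k + 1) dvd d * a ^ (k + 1)" unfolding eq' by simp
  hence "b ^ (k + 1) dvd d"
    using cop by (metis coprime_commute coprime_dvd_mult_left_iff)
  moreover have "a ^ (k + 1) dvd d' * b ^ (k + 1)" unfolding eq'[symmetric] by simp
  hence "a ^ (k + 1) dvd d'"
    using cop by (metis coprime_dvd_mult_left_iff)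
  ultimately have "a = 1" "b = 1"
    using assms(1,2) S_power_dvd_eq_1 by blast+
  thus ?thesis using eq' ab by simp
qed

lemma has_sum_times_powers:
  fixes r :: real
  assumes "K > 0" "real K * r > 1" "d > 0"
  shows "((\<lambda>n. real n powr (- r)) has_sum (real d powr (- r) * zeta (real K * r)))
           ((\<lambda>m. d * m ^ K) ` {0<..})"
proof -
  have inj: "inj_on (\<lambda>m. d * m ^ K) {0<..}"
    using assms(1,3) by (auto simp: inj_on_def power_eq_iff_eq_base)
  have term_eq: "real (d * m ^ K) powr (- r) = real d powr (- r) * real m powr (- (real K * r))"
    if "m > 0" for m
    using that by (simp add: powr_mult powr_powr flip: powr_realpow)
  have "((\<lambda>m. real d powr (- r) * real m powr (- (real K * r)))
          has_sum (real d powr (- r) * zeta (real K * r))) {0<..}"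
    by (intro has_sum_cmult_right zeta_has_sum assms)
  hence "((\<lambda>m. real (d * m ^ K) powr (- r))
          has_sum (real d powr (- r) * zeta (real K * r))) {0<..}"
    using term_eq by (subst has_sum_cong) (auto simp del: of_nat_mult of_nat_power)
  thus ?thesis
    by (subst has_sum_reindex[OF inj]) (simp add: comp_def)
qed

text \<open>
  The sets \<open>A d\<close> below are disjoint for distinct divisors \<open>d\<close> of \<open>n\<close>. The assumption
  \<open>k > 0\<close> is what keeps large primes out of their union: with first powers, \<open>A 1\<close> would
  contain every positive integer.
\<close>

lemma sigma_times_zeta_less:
  fixes r :: real
  assumes "k > 0" "r > 1" "n \<in> S k"
  shows "sigma (- r) n * zeta (real (k + 1) * r) < zeta r"
proof -
  define D where "D = {d. d dvd n \<and> d > 0}"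
  define A where "A d = (\<lambda>m. d * m ^ (k + 1)) ` {0::nat<..}" for d
  let ?f = "\<lambda>n. real n powr (- r)"
  have n: "n > 0" using assms(3) by (simp add: S_def)
  have "finite D" using n by (simp add: D_def)
  have DS: "d \<in> S k" if "d \<in> D" for d
    using that S_dvd[OF assms(3)] by (simp add: D_def)
  have "1 * 1 < real (k + 1) * r"
    using assms(1,2) by (intro mult_strict_mono) auto
  hence Kr: "real (k + 1) * r > 1" by simp
  have "(?f has_sum (\<Sum>d\<in>D. real d powr (- r) * zeta (real (k + 1) * r))) (\<Union>d\<in>D. A d)"
  proof (rule sum_has_sum[OF \<open>finite D\<close>])
    show "(?f has_sum (real d powr (- r) * zeta (real (k + 1) * r))) (A d)" if "d \<in> D" for d
      unfolding A_def using that Kr by (intro has_sum_times_powers) (auto simp: D_def)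
    show "A d \<inter> A d' = {}" if "d \<in> D" "d' \<in> D" "d \<noteq> d'" for d d'
      unfolding A_def using S_times_power_unique[OF DS DS] that by blast
  qed
  hence sum: "(?f has_sum (sigma (- r) n * zeta (real (k + 1) * r))) (\<Union>d\<in>D. A d)"
    by (simp only: sigma_def D_def sum_distrib_right)
  obtain p where p: "prime p" "p > n" using bigger_prime by blast
  have "p \<notin> A d" if "d \<in> D" for d
  proof
    assume "p \<in> A d"
    then obtain m where m: "p = d * m ^ (k + 1)" by (auto simp: A_def)
    have d: "d > 0" "d < p" using that n p by (auto simp: D_def dest: dvd_imp_le)
    hence "\<not> p dvd d" by (auto dest: dvd_imp_le)
    moreover have "p dvd d * m ^ (k + 1)" using m by simp
    ultimately have "p dvd m"
      using p(1) by (auto simp: prime_dvd_mult_iff dest: prime_dvd_power)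
    hence "p ^ (k + 1) dvd p"
      using m by (metis dvd_power_same dvd_triv_right dvd_trans)
    hence "p ^ (k + 1) \<le> p ^ 1"
      using p(1) by (auto dest!: dvd_imp_le simp: prime_gt_0_nat)
    thus False
      using assms(1) power_le_imp_le_exp[OF prime_gt_1_nat[OF p(1)], of "k + 1" 1] by simp
  qed
  hence "p \<notin> (\<Union>d\<in>D. A d)" by blast
  with sum have "(?f has_sum (?f p + sigma (- r) n * zeta (real (k + 1) * r)))
                   (insert p (\<Union>d\<in>D. A d))"
    by (intro has_sum_insert)
  hence "?f p + sigma (- r) n * zeta (real (k + 1) * r) \<le> zeta r"
    by (rule has_sum_mono_neutral[OF _ zeta_has_sum[OF assms(2)]])
       (use p in \<open>auto simp: A_def D_def prime_gt_0_nat\<close>)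
  moreover have "?f p > 0" using p by (simp add: prime_gt_0_nat)
  ultimately show ?thesis by linarith
qed

lemma one_le_sigma:
  assumes "n > 0"
  shows "sigma t n \<ge> 1"
proof -
  have "(\<Sum>d\<in>{1}. real d powr t) \<le> (\<Sum>d | d dvd n \<and> d > 0. real d powr t)"
    using assms by (intro sum_mono2) auto
  thus ?thesis by (simp add: sigma_def)
qed

theorem mainTheorem2:
  fixes k :: nat and r :: real
  assumes "k > 0" and "r > 1"
  shows "sigma_on (- r) k ` S k \<subseteq> {1..<zeta r / zeta (real (k + 1) * r)}"
proof -
  have "1 * 1 < real (k + 1) * r"
    using assms by (intro mult_strict_mono) auto
  hence pos: "zeta (real (k + 1) * r) > 0"
    by (intro zeta_pos) simp
  have "sigma (- r) n \<ge> 1 \<and> sigma (- r) n < zeta r / zeta (real (k + 1) * r)"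
    if "n \<in> S k" for n
    using one_le_sigma[of n "- r"] sigma_times_zeta_less[OF assms that] that
    unfolding pos_less_divide_eq[OF pos] by (simp add: S_def)
  thus ?thesis by (auto simp: sigma_on_def)
qed

end
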